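(* Let $m>1$, $N\ge 3$ and $d\ge m^2$ be integers. Then the set $\mathrm{pMPS_n}(N,m,d)$ of normalized (heterogeneous) matrix product states with periodic boundary conditions and bond dimension $m$ on a ring of $N$ sites is not a closed subset of $(\mathbb C^d)^{\otimes N}$.
   Context: $\mathbb C^d$ has orthonormal basis $\{|\sigma\rangle:\sigma=1,\dots,d\}$ and $(\mathbb C^d)^{\otimes N}$ has product basis $|\boldsymbol\sigma\rangle=|\sigma_1\rangle\otimes\dots\otimes|\sigma_N\rangle$. Closedness is with respect to the norm topology. $\mathrm{pMPS_n}(N,m,d)$ is the set of all states $$|\Psi\rangle=\sum_{\boldsymbol\sigma}\operatorname{Tr}\!\left(A_1^{\sigma_1}A_2^{\sigma_2}\cdots A_N^{\sigma_N}\right)|\boldsymbol\sigma\rangle\quad\text{with}\quad\|\Psi\|=1,$$ where $A_1,\dots,A_N\in\mathbb C^{d\times m\times m}$ are arbitrary (site-dependent) order-3 tensors, each regarded as a collection of $m\times m$ matrices $A_i^1,\dots,A_i^d$. *)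

theory Defs
  imports "HOL-Analysis.Analysis"
begin

text \<open>
  Conventions.  The bond dimension \<open>m\<close>, the physical dimension \<open>d\<close> and the number of sites \<open>N\<close> are the
  cardinalities of finite index types \<open>'m\<close>, \<open>'d\<close> and \<open>'n\<close>.  The sites additionally carry a linear
  order, because the (noncommutative) matrix product is taken from the first to the last site.
  The space \<open>(\<complex>\<^sup>d)\<^sup>\<otimes>\<^sup>N\<close> is represented by coordinates in its orthonormal product basis, which is indexed
  by the configurations \<open>\<sigma>\<close>; the norm of this vector type is the Hilbert space norm.
\<close>

definition ket :: "'d ^ 'n::{finite,linorder} \<Rightarrow> complex ^ ('d::finite ^ 'n::{finite,linorder})" where
  "ket \<sigma> = axis \<sigma> 1"

definition site_prod ::
  "('n::{finite,linorder} \<Rightarrow> complex ^ 'm ^ 'm ^ 'd) \<Rightarrow> 'd::finite ^ 'n::{finite,linorder} \<Rightarrow> complex ^ 'm ^ 'm::finite" where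
  "site_prod A \<sigma> =
     foldr (**) (map (\<lambda>i. A i $ (\<sigma> $ i)) (sorted_list_of_set UNIV)) (mat 1)"

definition mps_state ::
  "('n::{finite,linorder} \<Rightarrow> complex ^ 'm::finite ^ 'm ^ 'd::finite) \<Rightarrow> complex ^ ('d ^ 'n::{finite,linorder})" where
  "mps_state A = (\<Sum>\<sigma>\<in>UNIV. trace (site_prod A \<sigma>) *s ket \<sigma>)"

text \<open>The bond index type does not occur in the type of the states, hence the \<open>itself\<close> argument.\<close>

definition pMPS_n ::
  "'m::finite itself \<Rightarrow> (complex ^ ('d::finite ^ 'n::{finite,linorder})) set" where
  "pMPS_n _ = {\<Psi>. norm \<Psi> = 1 \<and>
     (\<exists>A :: 'n \<Rightarrow> complex ^ 'm ^ 'm ^ 'd. \<Psi> = mps_state A)}"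

lemma mps_state_nth: "mps_state A $ \<sigma> = trace (site_prod A \<sigma>)"
  by (simp add: mps_state_def ket_def axis_def if_distrib cong: if_cong)

end

theory Submission
  imports Defs
begin

text \<open>
  Fix a bond index \<open>u\<close> and call a triple \<open>(i, j, k)\<close> mixed if it meets both classes \<open>{u}\<close> and \<open>- {u}\<close>.
  Encode pairs of bond indices by physical indices, through an injection \<open>e\<close>, and consider on the first
  three sites the sum of \<open>|e(i,j), e(j,k), e(k,i)\<rangle>\<close> over the mixed triples, all other sites being frozen.
  Giving a matrix unit \<open>E\<^sub>i\<^sub>j\<close> the weight \<open>t\<close> if \<open>i\<close> and \<open>j\<close> are in the same class produces \<open>t\<close> for each mixed
  triple and \<open>t\<^sup>3\<close> for every other one; after division by \<open>t\<close> this tends to the state above as \<open>t \<rightarrow> 0\<close>.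

  The limit is not a matrix product state.  Otherwise \<open>Tr (B\<^sub>p C\<^sub>q D\<^sub>r)\<close> would reproduce its coefficients, and,
  since every pair occurs in a mixed triple, the \<open>C\<^sub>q\<close> and the \<open>D\<^sub>r\<close> would both be bases of the matrix
  space.  For \<open>v \<noteq> u\<close> the only mixed triple starting with \<open>(v, v)\<close> is \<open>(v, v, u)\<close>, so \<open>X \<mapsto> B\<^sub>(\<^sub>v\<^sub>,\<^sub>v\<^sub>) X\<close> would have
  rank one, whereas its rank is a multiple of the bond dimension.
\<close>

section \<open>Trace duality, and the obstruction for the limit tensor\<close>

text \<open>With pairs of bond indices as row and column indices, duality says that two square
  matrices multiply to the identity. Their product in the other order is then the identity too, and
  its entries give the expansion.\<close>

lemma trace_mult_dual_expansion:
  fixes C T :: "'m::finite \<times> 'm \<Rightarrow> 'a::field ^ 'm ^ 'm"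
  assumes dual: "\<And>q q'. trace (C q ** T q') = of_bool (q = q')"
  shows "X $ a $ b = (\<Sum>q\<in>UNIV. trace (X ** T q) * C q $ a $ b)"
proof -
  define M :: "'a ^ ('m \<times> 'm) ^ ('m \<times> 'm)" where "M = (\<chi> q x. C q $ fst x $ snd x)"
  define W :: "'a ^ ('m \<times> 'm) ^ ('m \<times> 'm)" where "W = (\<chi> x q. T q $ snd x $ fst x)"
  have tr: "trace (Y ** T q) = (\<Sum>x\<in>UNIV. Y $ fst x $ snd x * T q $ snd x $ fst x)" for Y q
    by (simp add: trace_def matrix_matrix_mult_def UNIV_Times_UNIV[symmetric] sum.cartesian_product
        case_prod_unfold del: UNIV_Times_UNIV)
  have "M ** W = mat 1"
    using dual[unfolded tr] by (simp add: vec_eq_iff matrix_matrix_mult_def M_def W_def mat_def)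
  then have "W ** M = mat 1"
    by (simp add: matrix_left_right_inverse)
  then have "(W ** M) $ x $ (a, b) = of_bool (x = (a, b))" for x
    by (simp add: mat_def)
  then have WM: "(\<Sum>q\<in>UNIV. T q $ snd x $ fst x * C q $ a $ b) = of_bool (x = (a, b))" for x
    by (simp add: matrix_matrix_mult_def M_def W_def)
  have "(\<Sum>q\<in>UNIV. trace (X ** T q) * C q $ a $ b)
      = (\<Sum>q\<in>UNIV. \<Sum>x\<in>UNIV. X $ fst x $ snd x * (T q $ snd x $ fst x * C q $ a $ b))"
    by (simp add: tr sum_distrib_right mult.assoc)
  also have "\<dots> = (\<Sum>x\<in>UNIV. X $ fst x $ snd x * (\<Sum>q\<in>UNIV. T q $ snd x $ fst x * C q $ a $ b))"
    by (subst sum.swap) (simp add: sum_distrib_left)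
  also have "\<dots> = (\<Sum>x\<in>UNIV. if x = (a, b) then X $ fst x $ snd x else 0)"
    by (intro sum.cong) (auto simp: WM)
  also have "\<dots> = X $ a $ b"
    by simp
  finally show ?thesis ..
qed

lemma trace_mult3:
  "trace (X ** (Y ** Z)) = (\<Sum>i\<in>UNIV. \<Sum>j\<in>UNIV. \<Sum>k\<in>UNIV. X $ i $ j * Y $ j $ k * Z $ k $ i)"
  for X Y Z :: "'a::comm_semiring_1 ^ 'm::finite ^ 'm"
  by (simp add: trace_def matrix_matrix_mult_def sum_distrib_left mult.assoc)

definition mixed :: "'m \<Rightarrow> 'm \<Rightarrow> 'm \<Rightarrow> 'm \<Rightarrow> bool" where
  "mixed u i j k \<longleftrightarrow> \<not> ((i = u) = (j = u) \<and> (j = u) = (k = u))"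

lemma no_mixed_trace_representation:
  fixes B C D :: "'m::finite \<times> 'm \<Rightarrow> 'a::field ^ 'm ^ 'm"
  assumes "v \<noteq> u"
    and G: "\<And>i j j' k k' i'. trace (B (i, j) ** (C (j', k) ** D (k', i')))
      = of_bool (j = j' \<and> k = k' \<and> i = i' \<and> mixed u i j k)"
  shows False
proof -
  \<comment> \<open>\<open>\<kappa> x\<close> lies in the class opposite to \<open>x\<close>, so any
    triple containing both is mixed; this completes every pair to a mixed triple.\<close>
  define \<kappa> where "\<kappa> = (\<lambda>x. if x = u then v else u)"
  have mixed_\<kappa>: "mixed u (\<kappa> j) j k" "mixed u i (\<kappa> k) k" for i j k
    using \<open>v \<noteq> u\<close> by (auto simp: mixed_def \<kappa>_def)
  have "trace (C q ** (D (snd q', \<kappa> (fst q')) ** B (\<kappa> (fst q'), fst q'))) = of_bool (q = q')" for q q'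
    using G[of "\<kappa> (fst q')" "fst q'" "fst q" "snd q" "snd q'" "\<kappa> (fst q')"]
    by (subst matrix_mul_assoc, subst trace_mul_sym) (auto simp: mixed_\<kappa> prod_eq_iff)
  note C_expand = trace_mult_dual_expansion[of C "\<lambda>q. D (snd q, \<kappa> (fst q)) ** B (\<kappa> (fst q), fst q)", OF this]
  \<comment> \<open>Here \<open>D\<close> is the dual family, so a matrix whose traces against all
    \<open>D r\<close> vanish is zero.\<close>
  have "trace ((B (snd r, \<kappa> (fst r)) ** C (\<kappa> (fst r), fst r)) ** D r') = of_bool (r = r')" for r r'
    using G[of "snd r" "\<kappa> (fst r)" "\<kappa> (fst r)" "fst r" "fst r'" "snd r'"]
    by (auto simp: mixed_\<kappa> prod_eq_iff matrix_mul_assoc)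
  note D_expand = trace_mult_dual_expansion[of "\<lambda>r. B (snd r, \<kappa> (fst r)) ** C (\<kappa> (fst r), fst r)" D, OF this]
  let ?B = "B (v, v)"
  let ?K = "?B ** C (v, u)"
  have kernel: "?B ** C q = 0" if "q \<noteq> (v, u)" for q
  proof -
    have "trace ((?B ** C q) ** D r) = 0" for r
      using G[of v v "fst q" "snd q" "fst r" "snd r"] that \<open>v \<noteq> u\<close>
      by (cases q; cases r) (auto simp: mixed_def matrix_mul_assoc)
    then show ?thesis
      using D_expand[of "?B ** C q"] by (simp add: vec_eq_iff)
  qed
  \<comment> \<open>Expand \<open>X\<close> in the \<open>C q\<close>: by \<open>kernel\<close>,
    left multiplication by \<open>?B\<close> kills every term except that of
    \<open>C (v, u)\<close>.\<close>
  have rank1: "\<exists>\<alpha>. \<forall>a b. (?B ** X) $ a $ b = \<alpha> * ?K $ a $ b" for X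
  proof -
    define c where "c q = trace (X ** (D (snd q, \<kappa> (fst q)) ** B (\<kappa> (fst q), fst q)))" for q
    have c: "X $ x $ y = (\<Sum>q\<in>UNIV. c q * C q $ x $ y)" for x y
      unfolding c_def by (rule C_expand)
    have "(?B ** X) $ a $ b = c (v, u) * ?K $ a $ b" for a b
    proof -
      have "(?B ** X) $ a $ b = (\<Sum>l\<in>UNIV. \<Sum>q\<in>UNIV. c q * (?B $ a $ l * C q $ l $ b))"
        by (simp add: matrix_matrix_mult_def c sum_distrib_left mult.left_commute)
      also have "\<dots> = (\<Sum>q\<in>UNIV. c q * (?B ** C q) $ a $ b)"
        by (subst sum.swap) (simp add: matrix_matrix_mult_def sum_distrib_left)
      also have "\<dots> = (\<Sum>q\<in>UNIV. if q = (v, u) then c q * ?K $ a $ b else 0)"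
        by (intro sum.cong) (auto simp: kernel)
      finally show ?thesis
        by simp
    qed
    then show ?thesis by blast
  qed
  have "?B \<noteq> 0"
    using G[of v v v u u v] \<open>v \<noteq> u\<close> by (auto simp: mixed_def trace_def)
  then obtain a b where ab: "?B $ a $ b \<noteq> 0"
    by (auto simp: vec_eq_iff)
  \<comment> \<open>These are matrix units: row \<open>a\<close> of \<open>?B ** E k\<close> has the
    nonzero entry of \<open>?B\<close> at \<open>(a, b)\<close> in column \<open>k\<close> and zeros
    elsewhere. For \<open>k = u\<close> and \<open>k = v\<close> these rows are independent, yet
    both would be multiples of row \<open>a\<close> of \<open>?K\<close>.\<close>
  define E :: "'m \<Rightarrow> 'a ^ 'm ^ 'm" where "E k = (\<chi> x y. of_bool (x = b \<and> y = k))" for k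
  have BE: "(?B ** E k) $ a $ l = of_bool (l = k) * ?B $ a $ b" for k l
    by (simp add: matrix_matrix_mult_def E_def of_bool_conj if_distrib cong: if_cong)
  obtain \<alpha> \<beta> where \<alpha>: "\<And>l. (?B ** E u) $ a $ l = \<alpha> * ?K $ a $ l"
    and \<beta>: "\<And>l. (?B ** E v) $ a $ l = \<beta> * ?K $ a $ l"
    using rank1[of "E u"] rank1[of "E v"] by blast
  show False
    using \<alpha>[of u] \<alpha>[of v] \<beta>[of u] \<beta>[of v] ab \<open>v \<noteq> u\<close> by (simp add: BE)
qed

section \<open>Passing from normalized to unnormalized states\<close>

text \<open>The state is linear in each tensor, so the first site absorbs the factor. The case
  \<open>r = 0\<close> puts the zero vector in the range.\<close>

lemma mps_state_scaleR:
  fixes A :: "'n::{finite,linorder} \<Rightarrow> complex ^ 'm::finite ^ 'm ^ 'd::finite"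
  shows "r *\<^sub>R mps_state A \<in> range (mps_state :: ('n \<Rightarrow> complex ^ 'm ^ 'm ^ 'd) \<Rightarrow> _)"
proof -
  obtain a xs where xs: "sorted_list_of_set (UNIV :: 'n set) = a # xs"
    by (cases "sorted_list_of_set (UNIV :: 'n set)")
      (auto dest: arg_cong[of _ _ set])
  have "a \<notin> set xs"
    using distinct_sorted_list_of_set[of "UNIV :: 'n set"] by (simp add: xs)
  then have map_eq: "map (\<lambda>i. (A(a := r *\<^sub>R A a)) i $ (\<sigma> $ i)) xs = map (\<lambda>i. A i $ (\<sigma> $ i)) xs" for \<sigma>
    by auto
  have "trace ((r *\<^sub>R M) ** M') = r *\<^sub>R trace (M ** M')" for M M' :: "complex ^ 'm ^ 'm"
    by (simp add: trace_def matrix_matrix_mult_def scaleR_sum_right)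
  then have "r *\<^sub>R mps_state A = mps_state (A(a := r *\<^sub>R A a))"
    unfolding vec_eq_iff vector_scaleR_component mps_state_nth site_prod_def xs
      list.map foldr.simps o_apply map_eq by simp
  then show ?thesis by blast
qed

text \<open>Since the limit is nonzero, the normalized sequence converges as well and eventually
  lies in the closed set; rescaling its limit gives \<open>\<Psi>\<close>.\<close>

lemma range_mps_state_limit:
  fixes F :: "nat \<Rightarrow> complex ^ ('d::finite ^ 'n::{finite,linorder})"
  assumes "closed (pMPS_n TYPE('m::finite) :: (complex ^ ('d ^ 'n::{finite,linorder})) set)"
    and F: "\<And>k. F k \<in> range (mps_state :: ('n \<Rightarrow> complex ^ 'm ^ 'm ^ 'd) \<Rightarrow> _)"
    and lim: "F \<longlonglongrightarrow> \<Psi>" and "\<Psi> \<noteq> 0"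
  shows "\<Psi> \<in> range (mps_state :: ('n \<Rightarrow> complex ^ 'm ^ 'm ^ 'd) \<Rightarrow> _)"
proof -
  have "(\<lambda>k. inverse (norm (F k)) *\<^sub>R F k) \<longlonglongrightarrow> inverse (norm \<Psi>) *\<^sub>R \<Psi>"
    using lim \<open>\<Psi> \<noteq> 0\<close> by (intro tendsto_intros) auto
  moreover have "eventually (\<lambda>k. F k \<noteq> 0) sequentially"
    using lim \<open>\<Psi> \<noteq> 0\<close> by (rule tendsto_imp_eventually_ne)
  then have "eventually (\<lambda>k. inverse (norm (F k)) *\<^sub>R F k \<in> (pMPS_n TYPE('m) :: (complex ^ ('d ^ 'n::{finite,linorder})) set)) sequentially"
  proof eventually_elim
    case (elim k)
    obtain A :: "'n \<Rightarrow> complex ^ 'm ^ 'm ^ 'd" where "F k = mps_state A"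
      using F[of k] by blast
    then have "inverse (norm (F k)) *\<^sub>R F k \<in> range (mps_state :: ('n \<Rightarrow> complex ^ 'm ^ 'm ^ 'd) \<Rightarrow> _)"
      by (simp add: mps_state_scaleR)
    with elim show ?case
      by (auto simp: pMPS_n_def)
  qed
  ultimately have "inverse (norm \<Psi>) *\<^sub>R \<Psi> \<in> (pMPS_n TYPE('m) :: (complex ^ ('d ^ 'n::{finite,linorder})) set)"
    by (intro Lim_in_closed_set[OF assms(1) _ sequentially_bot])
  then obtain A :: "'n \<Rightarrow> complex ^ 'm ^ 'm ^ 'd" where "inverse (norm \<Psi>) *\<^sub>R \<Psi> = mps_state A"
    by (auto simp: pMPS_n_def)
  then have "\<Psi> = norm \<Psi> *\<^sub>R mps_state A"
    using \<open>\<Psi> \<noteq> 0\<close> by (metis norm_eq_zero right_inverse scaleR_one scaleR_scaleR)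
  then show ?thesis
    using mps_state_scaleR[of "norm \<Psi>" A] by simp
qed

section \<open>The approximating states and their limit\<close>

lemma sorted_list_of_UNIV_3:
  assumes "CARD('n::{finite,linorder}) \<ge> 3"
  obtains a b c xs where "sorted_list_of_set (UNIV :: 'n set) = a # b # c # xs"
    "distinct (a # b # c # xs)"
proof -
  have "Suc (Suc (Suc 0)) \<le> length (sorted_list_of_set (UNIV :: 'n set))"
    using assms by simp
  then obtain a b c xs where "sorted_list_of_set (UNIV :: 'n set) = a # b # c # xs"
    by (auto simp: Suc_le_length_iff simp del: length_sorted_list_of_set)
  with that show thesis
    by (metis distinct_sorted_list_of_set)
qed

definition unit_tensor :: "('m \<times> 'm \<Rightarrow> 'd) \<Rightarrow> ('m \<Rightarrow> 'm \<Rightarrow> complex) \<Rightarrow> complex ^ 'm::finite ^ 'm ^ 'd::finite" where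
  "unit_tensor e w = (\<chi> s i j. w i j * of_bool (s = e (i, j)))"

text \<open>
  In \<open>mixed_state\<close> the non-mixed triples keep a coefficient \<open>z\<close>, so that \<open>z = t\<^sup>2\<close> is the approximating state
  and \<open>z = 0\<close> the limit.
\<close>

definition mixed_state ::
  "('m::finite \<times> 'm \<Rightarrow> 'd) \<Rightarrow> 'd \<Rightarrow> 'm \<Rightarrow> 'n::finite \<Rightarrow> 'n \<Rightarrow> 'n \<Rightarrow> complex \<Rightarrow> complex ^ ('d::finite ^ 'n)" where
  "mixed_state e s0 u a b c z = (\<chi> \<sigma>. of_bool (\<forall>x. x \<notin> {a, b, c} \<longrightarrow> \<sigma> $ x = s0) *
     (\<Sum>i\<in>UNIV. \<Sum>j\<in>UNIV. \<Sum>k\<in>UNIV. (if mixed u i j k then 1 else z) *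
        of_bool (\<sigma> $ a = e (i, j) \<and> \<sigma> $ b = e (j, k) \<and> \<sigma> $ c = e (k, i))))"

lemma mixed_state_in_range:
  fixes e :: "'m::finite \<times> 'm \<Rightarrow> 'd::finite" and a b c :: "'n::{finite,linorder}"
  assumes xs: "sorted_list_of_set (UNIV :: 'n set) = a # b # c # xs" "distinct (a # b # c # xs)"
    and "t \<noteq> 0"
  shows "mixed_state e s0 u a b c (t\<^sup>2) \<in> range (mps_state :: ('n \<Rightarrow> complex ^ 'm ^ 'm ^ 'd) \<Rightarrow> _)"
proof -
  define same where "same = (\<lambda>i j :: 'm. (i = u) = (j = u))"
  \<comment> \<open>The division by \<open>t\<close> is carried out on site \<open>a\<close>, where
    the weights \<open>t\<close> and \<open>1\<close> become \<open>1\<close> and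
    \<open>inverse t\<close>.\<close>
  define A :: "'n \<Rightarrow> complex ^ 'm ^ 'm ^ 'd" where
    "A x = (if x = a then unit_tensor e (\<lambda>i j. if same i j then 1 else inverse t)
       else if x = b \<or> x = c then unit_tensor e (\<lambda>i j. if same i j then t else 1)
       else (\<chi> s. if s = s0 then mat 1 else 0))" for x
  have A_abc: "A a = unit_tensor e (\<lambda>i j. if same i j then 1 else inverse t)"
    "A b = unit_tensor e (\<lambda>i j. if same i j then t else 1)"
    "A c = unit_tensor e (\<lambda>i j. if same i j then t else 1)"
    using xs(2) by (auto simp: A_def)
  \<comment> \<open>Going once around the triple, the class changes twice if it is mixed and never
    otherwise, so one or all three of the pairs are in the same class.\<close>
  have weights: "(if same i j then 1 else inverse t) * (if same j k then t else 1) * (if same k i then t else 1)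
      = (if mixed u i j k then 1 else t\<^sup>2)" for i j k
    using \<open>t \<noteq> 0\<close> by (cases "i = u"; cases "j = u"; cases "k = u")
      (simp_all add: same_def mixed_def power2_eq_square)
  have "UNIV = insert a (insert b (insert c (set xs)))"
    using set_sorted_list_of_set[of "UNIV :: 'n set"] by (simp add: xs)
  then have set_xs: "set xs = - {a, b, c}"
    using xs(2) by auto
  have idle: "foldr (**) (map (\<lambda>x. A x $ (\<sigma> $ x)) ys) (mat 1)
      = (if \<forall>x\<in>set ys. \<sigma> $ x = s0 then mat 1 else 0)"
    if "set ys \<subseteq> set xs" for \<sigma> ys
    using that by (induction ys) (auto simp: A_def set_xs)
  have "mps_state A $ \<sigma> = mixed_state e s0 u a b c (t\<^sup>2) $ \<sigma>" for \<sigma>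
  proof (cases "\<forall>x\<in>set xs. \<sigma> $ x = s0")
    case False
    then show ?thesis
      by (auto simp: mps_state_nth site_prod_def xs idle mixed_state_def set_xs trace_def)
  next
    case True
    then have "mps_state A $ \<sigma> = trace (A a $ (\<sigma> $ a) ** (A b $ (\<sigma> $ b) ** A c $ (\<sigma> $ c)))"
      by (simp add: mps_state_nth site_prod_def xs idle)
    also have "\<dots> = (\<Sum>i\<in>UNIV. \<Sum>j\<in>UNIV. \<Sum>k\<in>UNIV. (if mixed u i j k then 1 else t\<^sup>2) *
        of_bool (\<sigma> $ a = e (i, j) \<and> \<sigma> $ b = e (j, k) \<and> \<sigma> $ c = e (k, i)))"
      unfolding trace_mult3 A_abc weights[symmetric]
      by (simp add: unit_tensor_def of_bool_conj mult_ac)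
    also have "\<dots> = mixed_state e s0 u a b c (t\<^sup>2) $ \<sigma>"
      using True by (auto simp: mixed_state_def set_xs)
    finally show ?thesis .
  qed
  then show ?thesis
    by (metis rangeI vec_eq_iff)
qed

lemma mixed_state_nth:
  fixes e :: "'m::finite \<times> 'm \<Rightarrow> 'd::finite"
  assumes "inj e" "distinct [a, b, c]"
    and \<sigma>: "\<sigma> $ a = e (i, j)" "\<sigma> $ b = e (j', k)" "\<sigma> $ c = e (k', i')"
      "\<And>x. x \<notin> {a, b, c} \<Longrightarrow> \<sigma> $ x = s0"
  shows "mixed_state e s0 u a b c 0 $ \<sigma> = of_bool (j = j' \<and> k = k' \<and> i = i' \<and> mixed u i j k)"
proof -
  \<comment> \<open>Injectivity leaves only the term \<open>(p, q, r) = (i, j, k)\<close>. Testing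
    the innermost summation index \<open>r\<close> first lets the three sums collapse one after
    another.\<close>
  have summand: "(if mixed u p q r then 1 else 0) * of_bool (e (i, j) = e (p, q) \<and> e (j', k) = e (q, r) \<and> e (k', i') = e (r, p))
      = (if r = k then if q = j then if p = i then of_bool (j = j' \<and> k = k' \<and> i = i' \<and> mixed u i j k) else 0 else 0 else 0 :: complex)"
    for p q r
    by (auto simp: inj_eq[OF \<open>inj e\<close>])
  then show ?thesis
    unfolding mixed_state_def vec_lambda_beta \<sigma>(1-3) summand using \<sigma>(4) by simp
qed

lemma mixed_state_not_in_range:
  fixes e :: "'m::finite \<times> 'm \<Rightarrow> 'd::finite" and a b c :: "'n::{finite,linorder}"
  assumes xs: "sorted_list_of_set (UNIV :: 'n set) = a # b # c # xs" "distinct (a # b # c # xs)"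
    and "inj e" "v \<noteq> u"
  shows "mixed_state e s0 u a b c 0 \<notin> range (mps_state :: ('n \<Rightarrow> complex ^ 'm ^ 'm ^ 'd) \<Rightarrow> _)"
proof
  assume "mixed_state e s0 u a b c 0 \<in> range (mps_state :: ('n \<Rightarrow> complex ^ 'm ^ 'm ^ 'd) \<Rightarrow> _)"
  then obtain A :: "'n \<Rightarrow> complex ^ 'm ^ 'm ^ 'd" where A: "mps_state A = mixed_state e s0 u a b c 0"
    by auto
  define R where "R = foldr (**) (map (\<lambda>x. A x $ s0) xs) (mat 1)"
  have dist: "distinct [a, b, c]"
    using xs(2) by auto
  show False
  proof (rule no_mixed_trace_representation[OF \<open>v \<noteq> u\<close>])
    fix i j j' k k' i'
    define \<sigma> :: "'d ^ 'n::{finite,linorder}" where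
      "\<sigma> = (\<chi> x. if x = a then e (i, j) else if x = b then e (j', k) else if x = c then e (k', i') else s0)"
    have map_eq: "map (\<lambda>x. A x $ (\<sigma> $ x)) xs = map (\<lambda>x. A x $ s0) xs"
      using xs(2) by (auto simp: \<sigma>_def)
    have "mps_state A $ \<sigma>
        = trace (A a $ e (i, j) ** (A b $ e (j', k) ** (A c $ e (k', i') ** R)))"
      unfolding mps_state_nth site_prod_def xs list.map foldr.simps o_apply map_eq R_def
      using dist by (auto simp: \<sigma>_def)
    moreover have "mixed_state e s0 u a b c 0 $ \<sigma> = of_bool (j = j' \<and> k = k' \<and> i = i' \<and> mixed u i j k)"
      using dist by (intro mixed_state_nth[OF \<open>inj e\<close> dist]) (auto simp: \<sigma>_def)
    ultimately show "trace (A a $ e (i, j) ** (A b $ e (j', k) ** (A c $ e (k', i') ** R)))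
        = of_bool (j = j' \<and> k = k' \<and> i = i' \<and> mixed u i j k)"
      by (simp add: A)
  qed
qed

theorem proposition5:
  assumes "CARD('m::finite) > 1"
    and "CARD('n::{finite,linorder}) \<ge> 3"
    and "CARD('d::finite) \<ge> CARD('m)\<^sup>2"
  shows "\<not> closed (pMPS_n TYPE('m) :: (complex ^ ('d ^ 'n::{finite,linorder})) set)"
proof
  assume closed: "closed (pMPS_n TYPE('m) :: (complex ^ ('d ^ 'n::{finite,linorder})) set)"
  obtain u v :: 'm where "v \<noteq> u"
    using assms(1) by (metis (full_types) card_le_Suc0_iff_eq finite leD One_nat_def)
  have "CARD('m \<times> 'm) \<le> CARD('d)"
    using assms(3) by (simp add: power2_eq_square)
  then obtain e :: "'m \<times> 'm \<Rightarrow> 'd" where "inj e"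
    using card_le_inj[of "UNIV :: ('m \<times> 'm) set" "UNIV :: 'd set"] by auto
  obtain a b c :: 'n and xs where
    xs: "sorted_list_of_set (UNIV :: 'n set) = a # b # c # xs" "distinct (a # b # c # xs)"
    using sorted_list_of_UNIV_3[OF assms(2)] .
  define \<Psi> :: "complex \<Rightarrow> complex ^ ('d ^ 'n::{finite,linorder})" where "\<Psi> = mixed_state e undefined u a b c"
  have not_in: "\<Psi> 0 \<notin> range (mps_state :: ('n \<Rightarrow> complex ^ 'm ^ 'm ^ 'd) \<Rightarrow> _)"
    unfolding \<Psi>_def by (rule mixed_state_not_in_range[OF xs \<open>inj e\<close> \<open>v \<noteq> u\<close>])
  \<comment> \<open>The zero vector is itself a matrix product state, by scaling with
    \<open>0\<close>.\<close>
  then have "\<Psi> 0 \<noteq> 0"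
    using mps_state_scaleR[of 0 "undefined :: 'n \<Rightarrow> complex ^ 'm ^ 'm ^ 'd"] by auto
  have in_range: "\<Psi> ((of_real (inverse (real (Suc k))))\<^sup>2) \<in> range (mps_state :: ('n \<Rightarrow> complex ^ 'm ^ 'm ^ 'd) \<Rightarrow> _)" for k
    unfolding \<Psi>_def by (rule mixed_state_in_range[OF xs])
      (simp only: of_real_eq_0_iff inverse_nonzero_iff_nonzero of_nat_eq_0_iff nat.distinct not_False_eq_True)
  \<comment> \<open>The parameter \<open>z\<close> enters \<open>mixed_state\<close> only through
    such conditionals, so continuity follows coordinatewise.\<close>
  have "((\<lambda>z. if Q then 1 else z) \<longlongrightarrow> (if Q then 1 else 0)) (at (0 :: complex))" for Q
    by simp
  then have "isCont \<Psi> 0"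
    unfolding \<Psi>_def mixed_state_def isCont_def
    by (intro vec_tendstoI, unfold vec_lambda_beta) (intro tendsto_intros)
  moreover have "(\<lambda>k. (complex_of_real (inverse (real (Suc k))))\<^sup>2) \<longlonglongrightarrow> (of_real 0)\<^sup>2"
    by (intro tendsto_intros LIMSEQ_inverse_real_of_nat)
  then have "(\<lambda>k. (complex_of_real (inverse (real (Suc k))))\<^sup>2) \<longlonglongrightarrow> 0"
    by (simp only: of_real_0 zero_power2)
  ultimately have lim: "(\<lambda>k. \<Psi> ((of_real (inverse (real (Suc k))))\<^sup>2)) \<longlonglongrightarrow> \<Psi> 0"
    by (rule isCont_tendsto_compose)
  have "\<Psi> 0 \<in> range (mps_state :: ('n \<Rightarrow> complex ^ 'm ^ 'm ^ 'd) \<Rightarrow> _)"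
    by (rule range_mps_state_limit[OF closed _ lim \<open>\<Psi> 0 \<noteq> 0\<close>]) (rule in_range)
  with not_in show False ..
qed

end
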